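(* Let $R$ be a (possibly noncommutative) ring in which the left and right annihilators of each two-sided ideal coincide. The following conditions are equivalent: (1) $R$ is a semiprime ring; (2) the radical-annihilator monoid of $R$ is abelian, i.e. $ra=ar$; (3) annihilator ideals of $R$ are semiprime, i.e. $ra=a$; (4) $ar(I)=a(I)$ for every ideal $I$ of $R$, i.e. $ar=a$; (5) $a^2$ dominates $r$, i.e. $r\le a^2$. Consequently, the radical-annihilator monoid of a ring satisfying these conditions must be a submonoid of $\{1,a,a^2,r\}$.
   Context: Rings have an identity; "ideal" means two-sided ideal. A proper ideal $P$ is prime if for all ideals $I,J$, $IJ\subseteq P$ implies $I\subseteq P$ or $J\subseteq P$. An ideal $Q$ is semiprime if for every ideal $I$, $I^n\subseteq Q$ for some $n$ implies $I\subseteq Q$ (so $R$ itself is a semiprime ideal); $R$ is a semiprime ring if $\{0\}$ is a semiprime ideal. For an ideal $I$, $r(I)$ is the intersection of all prime ideals containing $I$ (with $r(R)=R$), and $a(I)$ is the common value of the left and right annihilators of $I$. Both $r$ and $a$ are maps from the set of ideals of $R$ to itself; products denote composition, e.g. $ra(I)=r(a(I))$, and $1$ is the identity map. The radical-annihilator monoid of $R$ is the monoid of maps generated by $r$ and $a$ under composition. For maps $f,g$ on ideals, $f\le g$ means $f(I)\subseteq g(I)$ for every ideal $I$. In $\{1,a,a^2,r\}$ the listed maps need not be distinct. *)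

theory Defs
  imports "HOL-Algebra.Ideal_Product"
begin

text \<open>The library's \<^const>\<open>primeideal\<close> is elementwise and only for commutative rings.\<close>

definition nc_prime_ideal :: "('a, 'b) ring_scheme \<Rightarrow> 'a set \<Rightarrow> bool" where
  "nc_prime_ideal R P \<longleftrightarrow>
     ideal P R \<and> P \<noteq> carrier R \<and>
     (\<forall>I J. ideal I R \<longrightarrow> ideal J R \<longrightarrow> I \<cdot>\<^bsub>R\<^esub> J \<subseteq> P \<longrightarrow> I \<subseteq> P \<or> J \<subseteq> P)"

text \<open>The power is taken in \<^const>\<open>ideals_set\<close>, i.e. with respect to the product of ideals.
  The zeroth power is the whole ring, so \<open>n = 0\<close> imposes no condition.\<close>

definition semiprime_ideal :: "('a, 'b) ring_scheme \<Rightarrow> 'a set \<Rightarrow> bool" where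
  "semiprime_ideal R Q \<longleftrightarrow>
     ideal Q R \<and>
     (\<forall>I. ideal I R \<longrightarrow> (\<exists>n::nat. I [^]\<^bsub>ideals_set R\<^esub> n \<subseteq> Q) \<longrightarrow> I \<subseteq> Q)"

definition semiprime_ring :: "('a, 'b) ring_scheme \<Rightarrow> bool" where
  "semiprime_ring R \<longleftrightarrow> ring R \<and> semiprime_ideal R {\<zero>\<^bsub>R\<^esub>}"

definition left_annihilator :: "('a, 'b) ring_scheme \<Rightarrow> 'a set \<Rightarrow> 'a set" where
  "left_annihilator R I = {x \<in> carrier R. \<forall>i\<in>I. x \<otimes>\<^bsub>R\<^esub> i = \<zero>\<^bsub>R\<^esub>}"

definition right_annihilator :: "('a, 'b) ring_scheme \<Rightarrow> 'a set \<Rightarrow> 'a set" where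
  "right_annihilator R I = {x \<in> carrier R. \<forall>i\<in>I. i \<otimes>\<^bsub>R\<^esub> x = \<zero>\<^bsub>R\<^esub>}"

text \<open>Maps on ideals are kept extensional, so that equality of maps is equality on all ideals;
  the product is composition, \<open>(f \<otimes> g) I = f (g I)\<close>.\<close>

definition ideal_maps :: "('a, 'b) ring_scheme \<Rightarrow> ('a set \<Rightarrow> 'a set) monoid" where
  "ideal_maps R =
     \<lparr> carrier = {I. ideal I R} \<rightarrow>\<^sub>E {I. ideal I R},
       mult = compose {I. ideal I R},
       one = (\<lambda>I\<in>{I. ideal I R}. I) \<rparr>"

definition ideal_map_le ::
  "('a, 'b) ring_scheme \<Rightarrow> ('a set \<Rightarrow> 'a set) \<Rightarrow> ('a set \<Rightarrow> 'a set) \<Rightarrow> bool" where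
  "ideal_map_le R f g \<longleftrightarrow> (\<forall>I. ideal I R \<longrightarrow> f I \<subseteq> g I)"

text \<open>Intersecting with the carrier covers the case that no prime ideal contains \<open>I\<close>,
  so that the radical of the whole ring is the whole ring.\<close>

definition radical_map :: "('a, 'b) ring_scheme \<Rightarrow> 'a set \<Rightarrow> 'a set" where
  "radical_map R = (\<lambda>I\<in>{I. ideal I R}. carrier R \<inter> \<Inter>{P. nc_prime_ideal R P \<and> I \<subseteq> P})"

text \<open>The left annihilator is used; this map is only meant for rings in which the left and right
  annihilators of every ideal coincide.\<close>

definition annihilator_map :: "('a, 'b) ring_scheme \<Rightarrow> 'a set \<Rightarrow> 'a set" where
  "annihilator_map R = (\<lambda>I\<in>{I. ideal I R}. left_annihilator R I)"

inductive_set monoid_generate :: "('m, 'n) monoid_scheme \<Rightarrow> 'm set \<Rightarrow> 'm set"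
  for G and S where
    one: "\<one>\<^bsub>G\<^esub> \<in> monoid_generate G S"
  | incl: "s \<in> S \<Longrightarrow> s \<in> monoid_generate G S"
  | mult: "x \<in> monoid_generate G S \<Longrightarrow> y \<in> monoid_generate G S \<Longrightarrow>
      x \<otimes>\<^bsub>G\<^esub> y \<in> monoid_generate G S"

definition radical_annihilator_monoid ::
  "('a, 'b) ring_scheme \<Rightarrow> ('a set \<Rightarrow> 'a set) monoid" where
  "radical_annihilator_monoid R =
     (ideal_maps R)\<lparr> carrier := monoid_generate (ideal_maps R) {radical_map R, annihilator_map R} \<rparr>"

end

theory Submission
  imports Defs "HOL-Algebra.Ring_Divisibility"
begin

text \<open>
  The ring-theoretic core is the theorem of Levitzki and Nagata that a semiprime ideal is an
  intersection of prime ideals, so that the fixed points of \<open>r\<close> are exactly the semiprime ideals.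
  Given a semiprime \<open>Q\<close> and \<open>x \<notin> Q\<close>, one chooses \<open>s 0 = x\<close> and \<open>s (n + 1) \<in> s n R s n\<close> outside \<open>Q\<close>;
  an ideal above \<open>Q\<close> that is maximal among those avoiding the sequence is prime.
  In a semiprime ring every \<open>a(I)\<close> is semiprime, hence \<open>ra = a\<close>; as \<open>a\<^sup>2(I)\<close> is then a semiprime ideal
  containing \<open>I\<close>, also \<open>r \<le> a\<^sup>2\<close>, and \<open>ar = a\<close> follows from \<open>a\<^sup>3 = a\<close>.
  Conversely, each condition evaluated at the zero ideal or at \<open>R\<close> gives \<open>r(0) = 0\<close>.
\<close>

section \<open>Semiprime ideals and the prime radical\<close>

context ring
begin

text \<open>Negatives come for free, since \<open>\<ominus> x\<close> is the product of
  \<open>\<ominus> \<one>\<close> and \<open>x\<close>. The rule serves for the sets of multipliers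
  and annihilators built below.\<close>

lemma ideal_setI:
  assumes "I \<subseteq> carrier R" "\<zero> \<in> I"
    and "\<And>x y. x \<in> I \<Longrightarrow> y \<in> I \<Longrightarrow> x \<oplus> y \<in> I"
    and l: "\<And>x y. x \<in> I \<Longrightarrow> y \<in> carrier R \<Longrightarrow> y \<otimes> x \<in> I"
    and "\<And>x y. x \<in> I \<Longrightarrow> y \<in> carrier R \<Longrightarrow> x \<otimes> y \<in> I"
  shows "ideal I R"
proof (rule idealI)
  have "\<ominus> x \<in> I" if "x \<in> I" for x
  proof -
    have "\<ominus> x = (\<ominus> \<one>) \<otimes> x"
      using that assms(1) by (simp add: l_minus subsetD)
    then show ?thesis
      using l[OF that, of "\<ominus> \<one>"] by simp
  qed
  then show "subgroup I (add_monoid R)"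
    using assms by (auto simp: subgroup_def a_inv_def)
qed (use assms ring_axioms in auto)

lemma ideal_zeroD: "ideal I R \<Longrightarrow> \<zero> \<in> I"
  by (simp add: additive_subgroup.zero_closed ideal.axioms(1))

lemma ideal_addD: "ideal I R \<Longrightarrow> x \<in> I \<Longrightarrow> y \<in> I \<Longrightarrow> x \<oplus> y \<in> I"
  by (simp add: additive_subgroup.a_closed ideal.axioms(1))

lemma ideal_subset_carrier: "ideal I R \<Longrightarrow> I \<subseteq> carrier R"
  by (simp add: additive_subgroup.a_subset ideal.axioms(1))

lemma ideal_prod_subsetI:
  assumes "ideal K R" "\<And>i j. i \<in> I \<Longrightarrow> j \<in> J \<Longrightarrow> i \<otimes> j \<in> K"
  shows "I \<cdot> J \<subseteq> K"
proof
  fix s assume "s \<in> I \<cdot> J"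
  then show "s \<in> K"
    by induct (auto intro: assms ideal_addD)
qed

lemma ideal_prod_mono: "I \<subseteq> I' \<Longrightarrow> J \<subseteq> J' \<Longrightarrow> I \<cdot> J \<subseteq> I' \<cdot> J'"
proof
  fix s assume "I \<subseteq> I'" "J \<subseteq> J'" "s \<in> I \<cdot> J"
  from this(3,1,2) show "s \<in> I' \<cdot> J'"
    by induct (auto intro: ideal_prod.intros)
qed

lemma ideals_set_simps [simp]:
  "\<one>\<^bsub>ideals_set R\<^esub> = carrier R" "I \<otimes>\<^bsub>ideals_set R\<^esub> J = I \<cdot> J"
  by (simp_all add: ideals_set_def)

lemma ideals_set_pow_ideal:
  "ideal I R \<Longrightarrow> ideal (I [^]\<^bsub>ideals_set R\<^esub> (n::nat)) R"
  by (induct n) (simp_all add: oneideal ideal_prod_is_ideal)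

text \<open>Only squares need testing: if a power \<open>K\<close> of \<open>I\<close> with positive
  exponent satisfies \<open>K \<cdot> I \<subseteq> Q\<close>, then \<open>K \<subseteq> I\<close>
  gives \<open>K \<cdot> K \<subseteq> Q\<close> and hence \<open>K \<subseteq> Q\<close>. The
  exponent thus drops by one until it is 1.\<close>

lemma semiprime_ideal_iff_square:
  assumes Q: "ideal Q R"
  shows "semiprime_ideal R Q \<longleftrightarrow> (\<forall>I. ideal I R \<longrightarrow> I \<cdot> I \<subseteq> Q \<longrightarrow> I \<subseteq> Q)"
proof
  assume semi: "semiprime_ideal R Q"
  show "\<forall>I. ideal I R \<longrightarrow> I \<cdot> I \<subseteq> Q \<longrightarrow> I \<subseteq> Q"
  proof (intro allI impI)
    fix I assume I: "ideal I R" "I \<cdot> I \<subseteq> Q"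
    \<comment> \<open>Powers start from \<open>carrier R\<close>, so the second power unfolds to
      \<open>(carrier R \<cdot> I) \<cdot> I\<close> rather than to
      \<open>I \<cdot> I\<close>.\<close>
    have "carrier R \<cdot> I \<subseteq> I"
      using I(1) ideal_prod_inter oneideal by blast
    then have "I [^]\<^bsub>ideals_set R\<^esub> (Suc (Suc 0)) \<subseteq> I \<cdot> I"
      by (simp add: ideal_prod_mono)
    then show "I \<subseteq> Q"
      using semi I unfolding semiprime_ideal_def by blast
  qed
next
  assume sq: "\<forall>I. ideal I R \<longrightarrow> I \<cdot> I \<subseteq> Q \<longrightarrow> I \<subseteq> Q"
  have "I \<subseteq> Q" if I: "ideal I R" and "I [^]\<^bsub>ideals_set R\<^esub> (n::nat) \<subseteq> Q" for I n
    using that(2)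
  proof (induct n)
    case 0
    then show ?case
      using ideal_subset_carrier[OF I] by auto
  next
    case (Suc n)
    show ?case
    proof (cases n)
      case 0
      \<comment> \<open>The first power is \<open>carrier R \<cdot> I\<close>, which contains each
        \<open>x\<close> of \<open>I\<close> as \<open>\<one> \<otimes> x\<close>.\<close>
      have "I \<subseteq> carrier R \<cdot> I"
      proof
        fix x assume "x \<in> I"
        then show "x \<in> carrier R \<cdot> I"
          using ideal_prod.prod[of \<one> "carrier R" x I R] ideal_subset_carrier[OF I] by auto
      qed
      then show ?thesis
        using Suc.prems by (auto simp: 0)
    next
      case (Suc m)
      let ?K = "I [^]\<^bsub>ideals_set R\<^esub> n"
      have "?K \<subseteq> I"
        using ideal_prod_inter[OF ideals_set_pow_ideal[OF I, of m] I]
        by (auto simp: Suc)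
      then have "?K \<cdot> ?K \<subseteq> ?K \<cdot> I"
        by (intro ideal_prod_mono) auto
      then have "?K \<cdot> ?K \<subseteq> Q"
        using Suc.prems by auto
      then have "?K \<subseteq> Q"
        using sq ideals_set_pow_ideal[OF I] by blast
      then show ?thesis
        by (rule Suc.hyps)
    qed
  qed
  then show "semiprime_ideal R Q"
    using Q unfolding semiprime_ideal_def by blast
qed

text \<open>Otherwise \<open>x R x\<close> lies in \<open>Q\<close>, and then so does the square of
  the ideal generated by \<open>x\<close>, which forces \<open>x\<close> into \<open>Q\<close>. The
  passage from \<open>x\<close> to its ideal is made one factor at a time, the right factor
  first.\<close>

lemma semiprime_ideal_ex_mult:
  assumes Q: "semiprime_ideal R Q" and x: "x \<in> carrier R" "x \<notin> Q"
  obtains y where "y \<in> carrier R" "x \<otimes> y \<otimes> x \<notin> Q"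
proof (rule ccontr)
  assume "\<not> thesis"
  with that have xyx: "\<And>y. y \<in> carrier R \<Longrightarrow> x \<otimes> y \<otimes> x \<in> Q"
    by blast
  have Qi: "ideal Q R"
    using Q by (simp add: semiprime_ideal_def)
  let ?I = "Idl {x}"
  have I: "ideal ?I R" "x \<in> ?I"
    using x genideal_ideal genideal_self' by auto
  \<comment> \<open>The middle factor \<open>y\<close> makes \<open>K\<close> stable under left
    multiplication: in \<open>x y (w z)\<close> the element \<open>w\<close> is absorbed into
    \<open>y\<close>.\<close>
  define K where "K = {z \<in> carrier R. \<forall>y\<in>carrier R. x \<otimes> y \<otimes> z \<in> Q}"
  have "ideal K R"
  proof (rule ideal_setI)
    fix z w assume z: "z \<in> K" and w: "w \<in> carrier R"
    have zw: "z \<in> carrier R" "\<And>y. y \<in> carrier R \<Longrightarrow> x \<otimes> y \<otimes> z \<in> Q"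
      using z by (simp_all add: K_def)
    have "x \<otimes> y \<otimes> (w \<otimes> z) \<in> Q" if "y \<in> carrier R" for y
      using zw(2)[of "y \<otimes> w"] x w that zw(1) by (simp add: m_assoc)
    then show "w \<otimes> z \<in> K"
      using zw(1) w by (simp add: K_def)
    have "x \<otimes> y \<otimes> (z \<otimes> w) \<in> Q" if "y \<in> carrier R" for y
      using ideal.I_r_closed[OF Qi zw(2)[OF that] w] x w that zw(1) by (simp add: m_assoc)
    then show "z \<otimes> w \<in> K"
      using zw(1) w by (simp add: K_def)
  next
    show "K \<subseteq> carrier R" "\<zero> \<in> K"
      using x Qi by (auto simp: K_def ideal_zeroD)
    show "z \<oplus> w \<in> K" if "z \<in> K" "w \<in> K" for z w
      using that x ideal_addD[OF Qi] by (simp add: K_def r_distr)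
  qed
  moreover have "x \<in> K"
    using x xyx by (simp add: K_def)
  ultimately have IK: "?I \<subseteq> K"
    by (intro genideal_minimal) auto
  \<comment> \<open>The left factor is now freed in the same way. No middle factor is required,
    because \<open>?I\<close> absorbs multiplication from the left.\<close>
  define L where "L = {w \<in> carrier R. \<forall>z\<in>?I. w \<otimes> z \<in> Q}"
  have Icarr: "z \<in> carrier R" if "z \<in> ?I" for z
    using that ideal.Icarr[OF I(1)] by blast
  have "ideal L R"
  proof (rule ideal_setI)
    fix z w assume "z \<in> L" "w \<in> carrier R"
    then show "w \<otimes> z \<in> L"
      using Icarr ideal.I_l_closed[OF Qi] by (simp add: L_def m_assoc)
  next
    fix z w assume "z \<in> L" "w \<in> carrier R"
    then show "z \<otimes> w \<in> L"
      using Icarr ideal.I_l_closed[OF I(1)] by (simp add: L_def m_assoc)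
  next
    show "L \<subseteq> carrier R" "\<zero> \<in> L"
      using Icarr Qi by (auto simp: L_def ideal_zeroD)
    show "z \<oplus> w \<in> L" if "z \<in> L" "w \<in> L" for z w
      using that Icarr ideal_addD[OF Qi] by (simp add: L_def l_distr)
  qed
  moreover have "x \<otimes> z \<in> Q" if "z \<in> ?I" for z
  proof -
    \<comment> \<open>The choice \<open>y = \<one>\<close> in the definition of \<open>K\<close>
      puts \<open>x\<close> into \<open>L\<close>.\<close>
    have "x \<otimes> \<one> \<otimes> z \<in> Q"
      using that IK by (auto simp: K_def)
    then show ?thesis
      using x by simp
  qed
  then have "x \<in> L"
    using x by (simp add: L_def)
  ultimately have "?I \<subseteq> L"
    by (intro genideal_minimal) auto
  then have "?I \<cdot> ?I \<subseteq> Q"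
    by (intro ideal_prod_subsetI Qi) (auto simp: L_def)
  then have "?I \<subseteq> Q"
    using Q I(1) semiprime_ideal_iff_square[OF Qi] by blast
  then show False
    using I(2) x(2) by blast
qed

text \<open>The sequence replaces the multiplicative set of the commutative theory. Zorn's lemma
  yields an ideal \<open>P\<close> maximal among those above \<open>Q\<close> that miss all
  \<open>s n\<close>. If two ideals outside \<open>P\<close> had their product inside it, both sums
  with \<open>P\<close> would meet the sequence, and a later term would fall into
  \<open>P\<close>.\<close>

lemma prime_ideal_avoiding:
  assumes Q: "ideal Q R" and S0: "s 0 \<in> carrier R"
    and step: "\<And>n::nat. \<exists>y\<in>carrier R. s (Suc n) = s n \<otimes> y \<otimes> s n"
    and avoid: "\<And>n. s n \<notin> Q"
  obtains P where "nc_prime_ideal R P" "Q \<subseteq> P" "\<And>n. s n \<notin> P"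
proof -
  define A where "A = {P. ideal P R \<and> Q \<subseteq> P \<and> (\<forall>n. s n \<notin> P)}"
  have "\<exists>P\<in>A. \<forall>X\<in>A. P \<subseteq> X \<longrightarrow> X = P"
  proof (rule subset_Zorn_nonempty)
    show "A \<noteq> {}"
      using Q avoid by (auto simp: A_def)
  next
    fix C assume C: "C \<noteq> {}" "subset.chain A C"
    then have "subset.chain {I. ideal I R} C"
      by (auto simp: pred_on.chain_def A_def)
    then have "ideal (\<Union>C) R"
      using chain_Union_is_ideal[of C] C(1) by simp
    moreover have "C \<subseteq> A"
      using C(2) by (auto simp: pred_on.chain_def)
    ultimately show "\<Union>C \<in> A"
      using C(1) by (auto simp: A_def)
  qed
  then obtain P where P: "P \<in> A" and max: "\<And>X. X \<in> A \<Longrightarrow> P \<subseteq> X \<Longrightarrow> X = P"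
    by blast
  then have Pi: "ideal P R" and QP: "Q \<subseteq> P" and sP: "\<And>n. s n \<notin> P"
    by (auto simp: A_def)
  have s_carr: "s n \<in> carrier R" for n
  proof (induct n)
    case (Suc n)
    then show ?case using step[of n] by auto
  qed (rule S0)
  \<comment> \<open>Each term is a multiple of its predecessor, so an ideal that contains one term
    contains all later ones.\<close>
  have s_up: "s n \<in> K" if K: "ideal K R" and "s m \<in> K" "m \<le> n" for K m n
    using that(3,2)
  proof (induct n rule: dec_induct)
    case (step n)
    then have "s n \<in> K" by blast
    obtain y where "y \<in> carrier R" "s (Suc n) = s n \<otimes> y \<otimes> s n"
      using assms(3)[of n] by blast
    then show ?case
      using \<open>s n \<in> K\<close> s_carr ideal.I_l_closed[OF K] by simp
  qed
  \<comment> \<open>This is maximality of \<open>P\<close>: the sum is strictly larger and still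
    contains \<open>Q\<close>, so it cannot avoid the sequence.\<close>
  have meets: "\<exists>n. s n \<in> P <+> I" if I: "ideal I R" and "\<not> I \<subseteq> P" for I
  proof (rule ccontr)
    assume no: "\<nexists>n. s n \<in> P <+> I"
    have sub: "P \<subseteq> P <+> I" "I \<subseteq> P <+> I"
    proof -
      show "P \<subseteq> P <+> I"
      proof
        fix p assume "p \<in> P"
        then have "p \<oplus> \<zero> \<in> P <+> I"
          using ideal_zeroD[OF I] unfolding set_add_def' by blast
        then show "p \<in> P <+> I"
          using ideal.Icarr[OF Pi \<open>p \<in> P\<close>] by simp
      qed
      show "I \<subseteq> P <+> I"
      proof
        fix p assume "p \<in> I"
        then have "\<zero> \<oplus> p \<in> P <+> I"
          using ideal_zeroD[OF Pi] unfolding set_add_def' by blast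
        then show "p \<in> P <+> I"
          using ideal.Icarr[OF I \<open>p \<in> I\<close>] by simp
      qed
    qed
    with no QP have "P <+> I \<in> A"
      using add_ideals[OF Pi I] by (auto simp: A_def)
    with max sub that(2) show False by blast
  qed
  have "nc_prime_ideal R P"
    unfolding nc_prime_ideal_def
  proof (intro conjI allI impI)
    show "P \<noteq> carrier R"
      using sP[of 0] S0 by blast
  next
    fix I J assume I: "ideal I R" and J: "ideal J R" and IJ: "I \<cdot> J \<subseteq> P"
    show "I \<subseteq> P \<or> J \<subseteq> P"
    proof (rule ccontr)
      assume "\<not> ?thesis"
      then obtain m n where "s m \<in> P <+> I" "s n \<in> P <+> J"
        using meets I J by meson
      \<comment> \<open>Moving up to the larger index produces a single term lying in both
        sums.\<close>
      then have "s (max m n) \<in> P <+> I" "s (max m n) \<in> P <+> J"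
        using s_up[OF add_ideals[OF Pi I]] s_up[OF add_ideals[OF Pi J]] by (meson max.cobounded1 max.cobounded2)+
      then obtain k where "s k \<in> P <+> I" "s k \<in> P <+> J"
        by blast
      then obtain p i q j where p: "p \<in> P" "i \<in> I" "s k = p \<oplus> i" and q: "q \<in> P" "j \<in> J" "s k = q \<oplus> j"
        unfolding set_add_def' by blast
      obtain y where y: "y \<in> carrier R" "s (Suc k) = s k \<otimes> y \<otimes> s k"
        using step by blast
      have carr: "p \<in> carrier R" "q \<in> carrier R" "i \<in> carrier R" "j \<in> carrier R"
        using p q ideal.Icarr Pi I J by metis+
      \<comment> \<open>The left copy of \<open>s k\<close> is written as
        \<open>p \<oplus> i\<close> and, where needed, the right one as \<open>q \<oplus> j\<close>.
        Summands containing \<open>p\<close> or \<open>q\<close> lie in \<open>P\<close>; the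
        remaining one, \<open>i y j\<close>, lies in \<open>I \<cdot> J\<close>.\<close>
      have "s (Suc k) = p \<otimes> y \<otimes> s k \<oplus> i \<otimes> y \<otimes> s k"
        using y carr s_carr[of k] by (simp add: p(3) l_distr)
      also have "i \<otimes> y \<otimes> s k = i \<otimes> y \<otimes> q \<oplus> (i \<otimes> y) \<otimes> j"
        using y carr by (simp add: q(3) r_distr)
      finally have eq: "s (Suc k) = p \<otimes> y \<otimes> s k \<oplus> (i \<otimes> y \<otimes> q \<oplus> (i \<otimes> y) \<otimes> j)" .
      have "(i \<otimes> y) \<otimes> j \<in> P"
        using IJ ideal_prod.prod[of "i \<otimes> y" I j J R] p q y ideal.I_r_closed[OF I] by blast
      moreover have "p \<otimes> y \<otimes> s k \<in> P" "i \<otimes> y \<otimes> q \<in> P"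
        using p q y carr s_carr[of k] ideal.I_r_closed[OF Pi] ideal.I_l_closed[OF Pi] by auto
      ultimately have "s (Suc k) \<in> P"
        unfolding eq by (intro ideal_addD[OF Pi])
      then show False
        using sP by blast
    qed
  qed (rule Pi)
  then show thesis
    using that QP sP by blast
qed

lemma semiprime_ideal_separated:
  assumes Q: "semiprime_ideal R Q" and x: "x \<in> carrier R" "x \<notin> Q"
  obtains P where "nc_prime_ideal R P" "Q \<subseteq> P" "x \<notin> P"
proof -
  have "\<exists>y. y \<in> carrier R \<and> z \<otimes> y \<otimes> z \<notin> Q" if "z \<in> carrier R" "z \<notin> Q" for z
    by (rule semiprime_ideal_ex_mult[OF Q that]) blast
  then obtain f where f: "\<And>z. z \<in> carrier R \<Longrightarrow> z \<notin> Q \<Longrightarrow> f z \<in> carrier R \<and> z \<otimes> f z \<otimes> z \<notin> Q"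
    by metis
  \<comment> \<open>The function \<open>f\<close> selects a middle factor that keeps the product
    outside \<open>Q\<close>. Iteration from \<open>x\<close> gives the sequence to be avoided, and
    \<open>s 0 = x\<close> ensures that the prime found misses \<open>x\<close>.\<close>
  define s where "s n = ((\<lambda>z. z \<otimes> f z \<otimes> z) ^^ n) x" for n
  have s0: "s 0 = x" and sS: "s (Suc n) = s n \<otimes> f (s n) \<otimes> s n" for n
    by (simp_all add: s_def)
  have s: "s n \<in> carrier R \<and> s n \<notin> Q" for n
    by (induct n) (use x f in \<open>auto simp: s0 sS\<close>)
  have "ideal Q R"
    using Q by (simp add: semiprime_ideal_def)
  then obtain P where "nc_prime_ideal R P" "Q \<subseteq> P" "\<And>n. s n \<notin> P"
  proof (rule prime_ideal_avoiding[of Q s])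
    show "\<exists>y\<in>carrier R. s (Suc n) = s n \<otimes> y \<otimes> s n" for n
      using s f sS by blast
  qed (use s in auto)
  then show thesis
    using that s0 by metis
qed

section \<open>The prime radical as a map on ideals\<close>

lemma radical_map_ideal:
  assumes I: "ideal I R"
  shows "ideal (radical_map R I) R"
proof -
  \<comment> \<open>Inserting \<open>carrier R\<close> keeps the family nonempty even if no prime
    lies above \<open>I\<close>, and matches the intersection with the carrier in
    \<open>radical_map\<close>.\<close>
  have "ideal (\<Inter>(insert (carrier R) {P. nc_prime_ideal R P \<and> I \<subseteq> P})) R"
    by (rule i_Intersect) (auto simp: nc_prime_ideal_def oneideal)
  then show ?thesis
    using I by (simp add: radical_map_def)
qed

lemma radical_map_upper: "ideal I R \<Longrightarrow> I \<subseteq> radical_map R I"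
  using ideal_subset_carrier by (auto simp: radical_map_def)

lemma radical_map_mono:
  "ideal I R \<Longrightarrow> ideal J R \<Longrightarrow> I \<subseteq> J \<Longrightarrow> radical_map R I \<subseteq> radical_map R J"
  by (auto simp: radical_map_def)

lemma radical_map_semiprime:
  assumes I: "ideal I R"
  shows "semiprime_ideal R (radical_map R I)"
  unfolding semiprime_ideal_iff_square[OF radical_map_ideal[OF I]]
proof (intro allI impI)
  fix J assume J: "ideal J R" "J \<cdot> J \<subseteq> radical_map R I"
  have "J \<subseteq> P" if "nc_prime_ideal R P" "I \<subseteq> P" for P
  proof -
    have "J \<cdot> J \<subseteq> P"
      using J(2) I that by (auto simp: radical_map_def)
    then show ?thesis
      using that(1) J(1) unfolding nc_prime_ideal_def by blast
  qed
  then show "J \<subseteq> radical_map R I"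
    using I ideal_subset_carrier[OF J(1)] by (auto simp: radical_map_def)
qed

text \<open>The Levitzki-Nagata theorem in fixed-point form. A radical is always semiprime;
  conversely, every point outside a semiprime ideal is missed by some prime above that
  ideal.\<close>

lemma radical_map_eq_iff:
  assumes I: "ideal I R"
  shows "radical_map R I = I \<longleftrightarrow> semiprime_ideal R I"
proof
  assume "radical_map R I = I"
  then show "semiprime_ideal R I"
    using radical_map_semiprime[OF I] by simp
next
  assume semi: "semiprime_ideal R I"
  have "x \<in> I" if "x \<in> radical_map R I" for x
  proof (rule ccontr)
    assume "x \<notin> I"
    moreover have "x \<in> carrier R"
      using that I by (simp add: radical_map_def)
    ultimately obtain P where "nc_prime_ideal R P" "I \<subseteq> P" "x \<notin> P"
      using semiprime_ideal_separated[OF semi] by blast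
    then show False
      using that I by (auto simp: radical_map_def)
  qed
  then show "radical_map R I = I"
    using radical_map_upper[OF I] by blast
qed

end

section \<open>Annihilators\<close>

context ring
begin

lemma annihilator_map_ideal:
  assumes I: "ideal I R"
  shows "ideal (annihilator_map R I) R"
proof -
  note carr = ideal.Icarr[OF I]
  have "ideal (left_annihilator R I) R"
  proof (rule ideal_setI)
    fix x y assume "x \<in> left_annihilator R I" "y \<in> carrier R"
    then show "y \<otimes> x \<in> left_annihilator R I" "x \<otimes> y \<in> left_annihilator R I"
      using carr ideal.I_l_closed[OF I] by (auto simp: left_annihilator_def m_assoc)
  qed (use carr in \<open>auto simp: left_annihilator_def l_distr\<close>)
  then show ?thesis
    using I by (simp add: annihilator_map_def)
qed

lemma annihilator_map_antimono:
  "ideal I R \<Longrightarrow> ideal J R \<Longrightarrow> I \<subseteq> J \<Longrightarrow> annihilator_map R J \<subseteq> annihilator_map R I"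
  by (auto simp: annihilator_map_def left_annihilator_def)

lemma annihilator_map_zero: "annihilator_map R {\<zero>} = carrier R"
  by (auto simp: annihilator_map_def left_annihilator_def zeroideal)

lemma annihilator_map_carrier: "annihilator_map R (carrier R) = {\<zero>}"
  by (auto simp: annihilator_map_def left_annihilator_def oneideal dest: bspec[of _ _ \<one>])

lemma annihilator_map_eq_carrierD:
  assumes "ideal I R" "annihilator_map R I = carrier R"
  shows "I = {\<zero>}"
proof -
  \<comment> \<open>An ideal annihilated by \<open>\<one>\<close> is zero.\<close>
  have "\<one> \<in> annihilator_map R I"
    using assms(2) by simp
  then have "i = \<zero>" if "i \<in> I" for i
    using that assms(1) l_one[OF ideal.Icarr[OF assms(1) that]]
    by (simp add: annihilator_map_def left_annihilator_def)
  then show ?thesis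
    using ideal_zeroD[OF assms(1)] by blast
qed

lemma semiprime_ring_iff: "semiprime_ring R \<longleftrightarrow> semiprime_ideal R {\<zero>}"
  by (simp add: semiprime_ring_def ring_axioms)

text \<open>If \<open>J J I = 0\<close>, then \<open>(J I)(J I) \<subseteq> J (J I) = 0\<close>, so
  semiprimeness of the zero ideal gives \<open>J I = 0\<close>.\<close>

lemma annihilator_map_semiprime:
  assumes semi: "semiprime_ring R" and I: "ideal I R"
  shows "semiprime_ideal R (annihilator_map R I)"
  unfolding semiprime_ideal_iff_square[OF annihilator_map_ideal[OF I]]
proof (intro allI impI)
  fix J assume J: "ideal J R" "J \<cdot> J \<subseteq> annihilator_map R I"
  have JI: "ideal (J \<cdot> I) R"
    using J I by (simp add: ideal_prod_is_ideal)
  have "(J \<cdot> I) \<cdot> (J \<cdot> I) \<subseteq> J \<cdot> (J \<cdot> I)"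
    using ideal_prod_inter[OF J(1) I] by (intro ideal_prod_mono) auto
  also have "\<dots> = (J \<cdot> J) \<cdot> I"
    by (simp add: ideal_prod_assoc J(1) I)
  also have "\<dots> \<subseteq> {\<zero>}"
    using J(2) I
    by (intro ideal_prod_subsetI zeroideal) (auto simp: annihilator_map_def left_annihilator_def)
  finally have "J \<cdot> I \<subseteq> {\<zero>}"
    using semi JI unfolding semiprime_ring_iff semiprime_ideal_iff_square[OF zeroideal] by blast
  then show "J \<subseteq> annihilator_map R I"
    using I ideal.Icarr[OF J(1)]
    by (auto simp: annihilator_map_def left_annihilator_def intro: ideal_prod.prod)
qed

text \<open>The test through which the conditions \<open>ra = ar\<close>, \<open>ar = a\<close> and
  \<open>r \<le> a^2\<close> are led back to semiprimeness.\<close>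

lemma semiprime_ring_iff_radical_zero: "semiprime_ring R \<longleftrightarrow> radical_map R {\<zero>} = {\<zero>}"
  by (simp add: semiprime_ring_iff radical_map_eq_iff zeroideal)

lemma radical_map_carrier: "radical_map R (carrier R) = carrier R"
  by (auto simp: radical_map_def oneideal)

end

section \<open>Rings whose ideals have equal left and right annihilators\<close>

locale annihilator_symmetric_ring = ring +
  assumes left_eq_right_annihilator:
    "\<And>I. ideal I R \<Longrightarrow> left_annihilator R I = right_annihilator R I"
begin

text \<open>Here the two sides must agree: read as a right annihilator, \<open>a(I)\<close> is
  killed from the left by every element of \<open>I\<close>, so \<open>I\<close> lies in the left
  annihilator of \<open>a(I)\<close>.\<close>

lemma annihilator_map_twice_upper:
  assumes I: "ideal I R"
  shows "I \<subseteq> annihilator_map R (annihilator_map R I)"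
proof -
  have "annihilator_map R I = right_annihilator R I"
    using I left_eq_right_annihilator by (simp add: annihilator_map_def)
  moreover have "annihilator_map R (annihilator_map R I) = left_annihilator R (annihilator_map R I)"
    using annihilator_map_ideal[OF I] by (simp add: annihilator_map_def)
  ultimately show ?thesis
    using ideal.Icarr[OF I] by (auto simp: left_annihilator_def right_annihilator_def)
qed

text \<open>The usual Galois argument: the order-reversing map applied to
  \<open>I \<subseteq> a^2(I)\<close> gives one inclusion, and the same bound for
  \<open>a(I)\<close> gives the other.\<close>

lemma annihilator_map_thrice:
  assumes I: "ideal I R"
  shows "annihilator_map R (annihilator_map R (annihilator_map R I)) = annihilator_map R I"
  using annihilator_map_antimono[OF I _ annihilator_map_twice_upper[OF I]]
    annihilator_map_twice_upper[OF annihilator_map_ideal[OF I]] annihilator_map_ideal I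
  by blast

lemma radical_le_annihilator_twice:
  assumes semi: "semiprime_ring R" and I: "ideal I R"
  shows "radical_map R I \<subseteq> annihilator_map R (annihilator_map R I)"
proof -
  have aa: "ideal (annihilator_map R (annihilator_map R I)) R"
    using I by (simp add: annihilator_map_ideal)
  have "radical_map R (annihilator_map R (annihilator_map R I)) = annihilator_map R (annihilator_map R I)"
    using radical_map_eq_iff[OF aa] annihilator_map_semiprime[OF semi] annihilator_map_ideal[OF I] by blast
  then show ?thesis
    using radical_map_mono[OF I aa annihilator_map_twice_upper[OF I]] by simp
qed

text \<open>Applying \<open>a\<close> to \<open>I \<subseteq> r(I) \<subseteq> a^2(I)\<close>
  encloses \<open>a(r(I))\<close> between \<open>a^3(I) = a(I)\<close> and
  \<open>a(I)\<close>.\<close>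

lemma annihilator_radical:
  assumes semi: "semiprime_ring R" and I: "ideal I R"
  shows "annihilator_map R (radical_map R I) = annihilator_map R I"
proof
  show "annihilator_map R (radical_map R I) \<subseteq> annihilator_map R I"
    using I by (intro annihilator_map_antimono radical_map_ideal radical_map_upper)
  have "annihilator_map R (annihilator_map R (annihilator_map R I)) \<subseteq> annihilator_map R (radical_map R I)"
    using semi I
    by (intro annihilator_map_antimono radical_map_ideal annihilator_map_ideal radical_le_annihilator_twice)
  then show "annihilator_map R I \<subseteq> annihilator_map R (radical_map R I)"
    using annihilator_map_thrice[OF I] by simp
qed

section \<open>The equivalences, stated ideal by ideal\<close>

lemma semiprime_ring_iff_annihilators_semiprime:
  "semiprime_ring R \<longleftrightarrow> (\<forall>I. ideal I R \<longrightarrow> semiprime_ideal R (annihilator_map R I))"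
  \<comment> \<open>For the converse take \<open>I = R\<close>, whose annihilator is the zero
    ideal.\<close>
  using annihilator_map_semiprime oneideal annihilator_map_carrier semiprime_ring_iff by metis

lemma semiprime_ring_iff_annihilator_radical:
  "semiprime_ring R \<longleftrightarrow>
     (\<forall>I. ideal I R \<longrightarrow> annihilator_map R (radical_map R I) = annihilator_map R I)"
proof
  assume "\<forall>I. ideal I R \<longrightarrow> annihilator_map R (radical_map R I) = annihilator_map R I"
  \<comment> \<open>At the zero ideal the condition says that all of \<open>R\<close> annihilates
    \<open>r(0)\<close>, so \<open>r(0) = 0\<close>.\<close>
  then have "annihilator_map R (radical_map R {\<zero>}) = carrier R"
    using zeroideal annihilator_map_zero by simp
  then show "semiprime_ring R"
    using annihilator_map_eq_carrierD radical_map_ideal zeroideal semiprime_ring_iff_radical_zero by blast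
qed (use annihilator_radical in blast)

lemma semiprime_ring_iff_radical_le:
  "semiprime_ring R \<longleftrightarrow>
     (\<forall>I. ideal I R \<longrightarrow> radical_map R I \<subseteq> annihilator_map R (annihilator_map R I))"
proof
  assume "\<forall>I. ideal I R \<longrightarrow> radical_map R I \<subseteq> annihilator_map R (annihilator_map R I)"
  \<comment> \<open>The bound at the zero ideal is \<open>a^2(0) = a(R) = 0\<close>.\<close>
  then have "radical_map R {\<zero>} \<subseteq> {\<zero>}"
    using zeroideal annihilator_map_zero annihilator_map_carrier by metis
  then show "semiprime_ring R"
    using radical_map_upper[OF zeroideal] semiprime_ring_iff_radical_zero by blast
qed (use radical_le_annihilator_twice in blast)

lemma semiprime_ring_iff_commute:
  "semiprime_ring R \<longleftrightarrow>
     (\<forall>I. ideal I R \<longrightarrow>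
        radical_map R (annihilator_map R I) = annihilator_map R (radical_map R I))"
proof
  assume "semiprime_ring R"
  then show "\<forall>I. ideal I R \<longrightarrow>
      radical_map R (annihilator_map R I) = annihilator_map R (radical_map R I)"
    using annihilator_radical annihilator_map_semiprime radical_map_eq_iff annihilator_map_ideal
    by metis
next
  assume "\<forall>I. ideal I R \<longrightarrow>
      radical_map R (annihilator_map R I) = annihilator_map R (radical_map R I)"
  \<comment> \<open>At \<open>I = R\<close> the left side is \<open>r(0)\<close> and the right side
    is \<open>a(R) = 0\<close>.\<close>
  then have "radical_map R (annihilator_map R (carrier R)) = annihilator_map R (radical_map R (carrier R))"
    using oneideal by blast
  then show "semiprime_ring R"
    by (simp add: radical_map_carrier annihilator_map_carrier semiprime_ring_iff_radical_zero)
qed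

end

section \<open>The radical-annihilator monoid\<close>

lemma ideal_maps_monoid: "monoid (ideal_maps R)"
proof (rule monoidI)
  fix f g h assume "f \<in> carrier (ideal_maps R)" "g \<in> carrier (ideal_maps R)" "h \<in> carrier (ideal_maps R)"
  then show "f \<otimes>\<^bsub>ideal_maps R\<^esub> g \<otimes>\<^bsub>ideal_maps R\<^esub> h = f \<otimes>\<^bsub>ideal_maps R\<^esub> (g \<otimes>\<^bsub>ideal_maps R\<^esub> h)"
    by (auto simp: ideal_maps_def compose_def fun_eq_iff restrict_def PiE_def)
qed (auto simp: ideal_maps_def compose_def fun_eq_iff restrict_def PiE_def extensional_def)

lemma ideal_maps_eqI:
  assumes "f \<in> carrier (ideal_maps R)" "g \<in> carrier (ideal_maps R)" "\<And>I. ideal I R \<Longrightarrow> f I = g I"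
  shows "f = g"
  using PiE_ext[of f "{I. ideal I R}" _ g] assms by (simp add: ideal_maps_def)

lemma ideal_maps_mult_apply: "ideal I R \<Longrightarrow> (f \<otimes>\<^bsub>ideal_maps R\<^esub> g) I = f (g I)"
  by (simp add: ideal_maps_def compose_def)

lemma monoid_generate_subset:
  assumes "submonoid F G" "S \<subseteq> F"
  shows "monoid_generate G S \<subseteq> F"
proof
  interpret submonoid F G by fact
  fix x assume "x \<in> monoid_generate G S"
  then show "x \<in> F"
  proof induct
    case (incl s)
    then show ?case using assms(2) by blast
  qed simp_all
qed

section \<open>Products of the two generators and the four-element monoid\<close>

context annihilator_symmetric_ring
begin

lemma radical_map_in_ideal_maps: "radical_map R \<in> carrier (ideal_maps R)"
  using radical_map_ideal by (auto simp: ideal_maps_def radical_map_def)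

lemma annihilator_map_in_ideal_maps: "annihilator_map R \<in> carrier (ideal_maps R)"
  using annihilator_map_ideal by (auto simp: ideal_maps_def annihilator_map_def)

lemma ideal_maps_eq_iff:
  assumes "f \<in> carrier (ideal_maps R)" "g \<in> carrier (ideal_maps R)"
  shows "f = g \<longleftrightarrow> (\<forall>I. ideal I R \<longrightarrow> f I = g I)"
  using ideal_maps_eqI[OF assms] by auto

text \<open>These relations determine the whole multiplication table. The first and third hold
  because \<open>a(I)\<close> and \<open>r(I)\<close> are semiprime, hence fixed by
  \<open>r\<close>.\<close>

lemma semiprime_ring_products:
  defines "M \<equiv> ideal_maps R" and "r \<equiv> radical_map R" and "a \<equiv> annihilator_map R"
  assumes semi: "semiprime_ring R"
  shows "r \<otimes>\<^bsub>M\<^esub> a = a" "a \<otimes>\<^bsub>M\<^esub> r = a" "r \<otimes>\<^bsub>M\<^esub> r = r" "a \<otimes>\<^bsub>M\<^esub> (a \<otimes>\<^bsub>M\<^esub> a) = a"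
proof -
  interpret M: monoid M
    unfolding M_def by (rule ideal_maps_monoid)
  note [simp] = radical_map_in_ideal_maps[folded M_def r_def]
    annihilator_map_in_ideal_maps[folded M_def a_def]
  note eqI = ideal_maps_eqI[where R = R, folded M_def]
    and app = ideal_maps_mult_apply[where R = R, folded M_def]
  show "r \<otimes>\<^bsub>M\<^esub> a = a"
    by (rule eqI)
      (simp_all add: app, simp add: r_def a_def radical_map_eq_iff annihilator_map_semiprime semi annihilator_map_ideal)
  show "a \<otimes>\<^bsub>M\<^esub> r = a"
    by (rule eqI) (simp_all add: app, simp add: r_def a_def annihilator_radical semi)
  show "r \<otimes>\<^bsub>M\<^esub> r = r"
    by (rule eqI) (simp_all add: app,
        simp add: r_def radical_map_eq_iff radical_map_semiprime radical_map_ideal)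
  show "a \<otimes>\<^bsub>M\<^esub> (a \<otimes>\<^bsub>M\<^esub> a) = a"
    by (rule eqI) (simp_all add: app, simp add: a_def annihilator_map_thrice)
qed

lemma semiprime_ring_submonoid:
  defines "M \<equiv> ideal_maps R" and "r \<equiv> radical_map R" and "a \<equiv> annihilator_map R"
  defines "F \<equiv> {\<one>\<^bsub>M\<^esub>, a, a \<otimes>\<^bsub>M\<^esub> a, r}"
  assumes semi: "semiprime_ring R"
  shows "submonoid F M" "\<And>f g. f \<in> F \<Longrightarrow> g \<in> F \<Longrightarrow> f \<otimes>\<^bsub>M\<^esub> g = g \<otimes>\<^bsub>M\<^esub> f"
proof -
  interpret M: monoid M
    unfolding M_def by (rule ideal_maps_monoid)
  have [simp]: "r \<in> carrier M" "a \<in> carrier M"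
    unfolding M_def r_def a_def
    by (simp_all add: radical_map_in_ideal_maps annihilator_map_in_ideal_maps)
  note prods [simp] = semiprime_ring_products[OF semi, folded M_def r_def a_def]
  \<comment> \<open>Reassociation yields the entries involving \<open>a^2\<close>. The completed
    table is closed and symmetric, which gives both claims.\<close>
  have [simp]: "(a \<otimes>\<^bsub>M\<^esub> a) \<otimes>\<^bsub>M\<^esub> a = a" "(a \<otimes>\<^bsub>M\<^esub> a) \<otimes>\<^bsub>M\<^esub> (a \<otimes>\<^bsub>M\<^esub> a) = a \<otimes>\<^bsub>M\<^esub> a" "(a \<otimes>\<^bsub>M\<^esub> a) \<otimes>\<^bsub>M\<^esub> r = a \<otimes>\<^bsub>M\<^esub> a"
    by (simp_all add: M.m_assoc)
  have [simp]: "r \<otimes>\<^bsub>M\<^esub> (a \<otimes>\<^bsub>M\<^esub> a) = a \<otimes>\<^bsub>M\<^esub> a"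
    by (simp add: M.m_assoc[symmetric])
  show "submonoid F M"
    by (rule submonoid.intro) (auto simp: F_def)
  show "f \<otimes>\<^bsub>M\<^esub> g = g \<otimes>\<^bsub>M\<^esub> f" if "f \<in> F" "g \<in> F" for f g
    using that by (auto simp: F_def)
qed

lemma radical_annihilator_monoid_submonoid:
  assumes semi: "semiprime_ring R"
  defines "M \<equiv> ideal_maps R" and "r \<equiv> radical_map R" and "a \<equiv> annihilator_map R"
  defines "F \<equiv> {\<one>\<^bsub>M\<^esub>, a, a \<otimes>\<^bsub>M\<^esub> a, r}"
  shows "comm_monoid (M\<lparr>carrier := F\<rparr>)"
    and "submonoid (carrier (radical_annihilator_monoid R)) (M\<lparr>carrier := F\<rparr>)"
proof -
  note F = semiprime_ring_submonoid[OF semi, folded M_def r_def a_def, folded F_def]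
  have "monoid (M\<lparr>carrier := F\<rparr>)"
    using submonoid.submonoid_is_monoid[OF F(1)] ideal_maps_monoid[of R] by (simp add: M_def)
  then show "comm_monoid (M\<lparr>carrier := F\<rparr>)"
    by (rule monoid.monoid_comm_monoidI) (use F(2) in simp)
  \<comment> \<open>Both generators lie in the submonoid \<open>F\<close>, so everything they
    generate does too.\<close>
  have "monoid_generate M {r, a} \<subseteq> F"
    by (rule monoid_generate_subset[OF F(1)]) (auto simp: F_def)
  then show "submonoid (carrier (radical_annihilator_monoid R)) (M\<lparr>carrier := F\<rparr>)"
    unfolding radical_annihilator_monoid_def
    by (simp add: submonoid_def monoid_generate.one monoid_generate.mult flip: M_def r_def a_def)
qed

section \<open>The equivalences as equations between maps\<close>

lemma semiprime_ring_iff_comm_maps: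
  "semiprime_ring R \<longleftrightarrow>
     radical_map R \<otimes>\<^bsub>ideal_maps R\<^esub> annihilator_map R = annihilator_map R \<otimes>\<^bsub>ideal_maps R\<^esub> radical_map R"
proof -
  interpret M: monoid "ideal_maps R"
    by (rule ideal_maps_monoid)
  show ?thesis
    unfolding semiprime_ring_iff_commute
    by (subst ideal_maps_eq_iff)
      (simp_all add: radical_map_in_ideal_maps annihilator_map_in_ideal_maps ideal_maps_mult_apply)
qed

text \<open>Commutativity is inherited from the four-element monoid; conversely, commuting
  generators already give \<open>ra = ar\<close>.\<close>

lemma semiprime_ring_iff_comm_monoid:
  "semiprime_ring R \<longleftrightarrow> comm_monoid (radical_annihilator_monoid R)"
proof
  assume "semiprime_ring R"
  from comm_monoid.submonoid_is_comm_monoid[OF radical_annihilator_monoid_submonoid[OF this]]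
  show "comm_monoid (radical_annihilator_monoid R)"
    by (simp add: radical_annihilator_monoid_def)
next
  assume "comm_monoid (radical_annihilator_monoid R)"
  then have "radical_map R \<otimes>\<^bsub>radical_annihilator_monoid R\<^esub> annihilator_map R
      = annihilator_map R \<otimes>\<^bsub>radical_annihilator_monoid R\<^esub> radical_map R"
    by (rule comm_monoid.m_comm)
      (auto simp: radical_annihilator_monoid_def intro: monoid_generate.incl)
  then show "semiprime_ring R"
    by (simp add: radical_annihilator_monoid_def semiprime_ring_iff_comm_maps)
qed

lemma semiprime_ring_iff_radical_mult_annihilator:
  "semiprime_ring R \<longleftrightarrow> radical_map R \<otimes>\<^bsub>ideal_maps R\<^esub> annihilator_map R = annihilator_map R"
proof -
  interpret M: monoid "ideal_maps R"
    by (rule ideal_maps_monoid)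
  show ?thesis
    unfolding semiprime_ring_iff_annihilators_semiprime
    by (subst ideal_maps_eq_iff)
      (simp_all add: radical_map_in_ideal_maps annihilator_map_in_ideal_maps ideal_maps_mult_apply
        radical_map_eq_iff annihilator_map_ideal)
qed

lemma semiprime_ring_iff_annihilator_mult_radical:
  "semiprime_ring R \<longleftrightarrow> annihilator_map R \<otimes>\<^bsub>ideal_maps R\<^esub> radical_map R = annihilator_map R"
proof -
  interpret M: monoid "ideal_maps R"
    by (rule ideal_maps_monoid)
  show ?thesis
    unfolding semiprime_ring_iff_annihilator_radical
    by (subst ideal_maps_eq_iff)
      (simp_all add: radical_map_in_ideal_maps annihilator_map_in_ideal_maps ideal_maps_mult_apply)
qed

end

theorem theorem4p10:
  fixes R :: "('a, 'b) ring_scheme"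
  assumes "ring R"
    and "\<And>I. ideal I R \<Longrightarrow> left_annihilator R I = right_annihilator R I"
  shows
    "let M = ideal_maps R; r = radical_map R; a = annihilator_map R;
         N = radical_annihilator_monoid R;
         F = {\<one>\<^bsub>M\<^esub>, a, a \<otimes>\<^bsub>M\<^esub> a, r}
     in (semiprime_ring R \<longleftrightarrow> comm_monoid N) \<and>
        (semiprime_ring R \<longleftrightarrow> r \<otimes>\<^bsub>M\<^esub> a = a \<otimes>\<^bsub>M\<^esub> r) \<and>
        (semiprime_ring R \<longleftrightarrow> (\<forall>I. ideal I R \<longrightarrow> semiprime_ideal R (a I))) \<and>
        (semiprime_ring R \<longleftrightarrow> r \<otimes>\<^bsub>M\<^esub> a = a) \<and>
        (semiprime_ring R \<longleftrightarrow> (\<forall>I. ideal I R \<longrightarrow> a (r I) = a I)) \<and>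
        (semiprime_ring R \<longleftrightarrow> a \<otimes>\<^bsub>M\<^esub> r = a) \<and>
        (semiprime_ring R \<longleftrightarrow> ideal_map_le R r (a \<otimes>\<^bsub>M\<^esub> a)) \<and>
        (semiprime_ring R \<longrightarrow>
           monoid (M\<lparr>carrier := F\<rparr>) \<and> submonoid (carrier N) (M\<lparr>carrier := F\<rparr>))"
proof -
  interpret annihilator_symmetric_ring R
    using assms by (simp add: annihilator_symmetric_ring_def annihilator_symmetric_ring_axioms_def)
  have "monoid (ideal_maps R\<lparr>carrier := {\<one>\<^bsub>ideal_maps R\<^esub>, annihilator_map R,
      annihilator_map R \<otimes>\<^bsub>ideal_maps R\<^esub> annihilator_map R, radical_map R}\<rparr>)"
    if "semiprime_ring R"
    using radical_annihilator_monoid_submonoid(1)[OF that] by (rule comm_monoid.axioms(1))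
  moreover have "semiprime_ring R \<longleftrightarrow> ideal_map_le R (radical_map R)
      (annihilator_map R \<otimes>\<^bsub>ideal_maps R\<^esub> annihilator_map R)"
    using semiprime_ring_iff_radical_le by (simp add: ideal_map_le_def ideal_maps_mult_apply)
  ultimately show ?thesis
    unfolding Let_def
    by (intro conjI impI semiprime_ring_iff_comm_monoid semiprime_ring_iff_comm_maps
        semiprime_ring_iff_annihilators_semiprime semiprime_ring_iff_radical_mult_annihilator
        semiprime_ring_iff_annihilator_radical semiprime_ring_iff_annihilator_mult_radical
        radical_annihilator_monoid_submonoid(2))
qed

end
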